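(* Let $M$ be a Puiseux monoid. If $M$ satisfies the ACCP, then $\mathcal{P}_{\mathrm{fin}}(M)$ also satisfies the ACCP.
   Context: All monoids are commutative semigroups with identity, written additively with identity $0$. A Puiseux monoid is a submonoid of $(\mathbb{Q}_{\ge 0},+)$. For a monoid $M$, the (finitary) power monoid $\mathcal{P}_{\mathrm{fin}}(M)$ is the set of all nonempty finite subsets of $M$ with operation $S+T := \{s+t \mid s\in S,\ t\in T\}$; its identity is $\{0\}$. For a monoid $N$, a principal ideal of $N$ is a subset of the form $b+N := \{b+s \mid s\in N\}$ with $b\in N$. The monoid $N$ satisfies the ascending chain condition on principal ideals (ACCP) if for every sequence $(r_n)_{n\in\mathbb{N}}$ of elements of $N$ with $r_n+N\subseteq r_{n+1}+N$ for all $n$, there is an $n_0\in\mathbb{N}$ such that $r_n+N=r_{n+1}+N$ for every $n\ge n_0$. *)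

theory Defs
  imports Complex_Main "HOL-Library.Set_Algebras"
begin

text \<open>
  Monoids are represented as submonoids of a type of class \<^class>\<open>comm_monoid_add\<close>.
  Set_Algebras makes \<^typ>\<open>rat set\<close> itself such a type, with
  \<open>S + T = {s + t | s t. s \<in> S \<and> t \<in> T}\<close> and \<open>0 = {0}\<close>, so the same notions
  apply to a Puiseux monoid and to its power monoid.
\<close>

definition add_submonoid :: "'a::comm_monoid_add set \<Rightarrow> bool" where
  "add_submonoid N \<longleftrightarrow> 0 \<in> N \<and> (\<forall>a\<in>N. \<forall>b\<in>N. a + b \<in> N)"

definition puiseux_monoid :: "rat set \<Rightarrow> bool" where
  "puiseux_monoid M \<longleftrightarrow> add_submonoid M \<and> M \<subseteq> {0..}"

definition power_monoid_fin :: "'a::comm_monoid_add set \<Rightarrow> 'a set set" where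
  "power_monoid_fin M = {S. S \<noteq> {} \<and> finite S \<and> S \<subseteq> M}"

text \<open>
  For \<open>b \<in> N\<close>, the coset \<open>b +o N = {b + s | s. s \<in> N}\<close> is the principal ideal generated by \<open>b\<close>.
\<close>

definition satisfies_accp :: "'a::comm_monoid_add set \<Rightarrow> bool" where
  "satisfies_accp N \<longleftrightarrow>
     (\<forall>r :: nat \<Rightarrow> 'a. (\<forall>n. r n \<in> N) \<and> (\<forall>n. r n +o N \<subseteq> r (Suc n) +o N) \<longrightarrow>
        (\<exists>n0. \<forall>n\<ge>n0. r n +o N = r (Suc n) +o N))"

lemma add_submonoid_power_monoid_fin:
  assumes "add_submonoid M"
  shows "add_submonoid (power_monoid_fin M)"
  unfolding add_submonoid_def
proof (intro conjI ballI)
  show "0 \<in> power_monoid_fin M"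
    using assms by (simp add: power_monoid_fin_def add_submonoid_def)
next
  fix S T assume "S \<in> power_monoid_fin M" "T \<in> power_monoid_fin M"
  then have ST: "S \<noteq> {}" "T \<noteq> {}" "finite S" "finite T" "S \<subseteq> M" "T \<subseteq> M"
    by (auto simp: power_monoid_fin_def)
  have eq: "S + T = (\<lambda>(s, t). s + t) ` (S \<times> T)"
    by (auto simp: set_plus_def)
  have "S + T \<subseteq> M"
    using ST assms by (force simp: set_plus_def add_submonoid_def)
  moreover have "finite (S + T)" "S + T \<noteq> {}"
    using ST unfolding eq by auto
  ultimately show "S + T \<in> power_monoid_fin M"
    by (simp add: power_monoid_fin_def)
qed

end

theory Submission
  imports Defs
begin

text \<open>
  A chain of principal ideals in the power monoid is a sequence of finite sets with
  \<open>S\<^sub>n = S\<^sub>n\<^sub>+\<^sub>1 + T\<^sub>n\<close>. Taking minima is additive, so the minima generate an ascending chain of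
  principal ideals of \<open>M\<close>, which stabilizes by hypothesis. As the elements of \<open>M\<close> are nonnegative,
  equal principal ideals have equal generators; hence eventually \<open>Min S\<^sub>n = Min S\<^sub>n\<^sub>+\<^sub>1\<close>, that is,
  \<open>Min T\<^sub>n = 0\<close>. From then on \<open>0 \<in> T\<^sub>n\<close> forces \<open>S\<^sub>n\<^sub>+\<^sub>1 \<subseteq> S\<^sub>n\<close>, and a descending sequence of finite
  sets is eventually constant.

  The argument uses only the order and cancellation, so it is carried out for the nonnegative
  submonoids of any linearly ordered cancellative commutative monoid.
\<close>

lemma principal_ideal_subset_iff:
  fixes N :: "'a::comm_monoid_add set"
  assumes "add_submonoid N"
  shows "a +o N \<subseteq> b +o N \<longleftrightarrow> (\<exists>t\<in>N. a = b + t)"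
proof
  assume sub: "a +o N \<subseteq> b +o N"
  have "a + 0 \<in> a +o N"
    using assms unfolding add_submonoid_def elt_set_plus_def by blast
  then have "a \<in> b +o N"
    using sub by auto
  then show "\<exists>t\<in>N. a = b + t"
    by (auto simp: elt_set_plus_def)
next
  assume "\<exists>t\<in>N. a = b + t"
  then obtain t where "t \<in> N" "a = b + t"
    by blast
  then show "a +o N \<subseteq> b +o N"
    using assms unfolding add_submonoid_def elt_set_plus_def by (auto simp: add.assoc)
qed

lemma generator_unique_if_nonneg:
  fixes N :: "'a::ordered_comm_monoid_add set"
  assumes "add_submonoid N" and nonneg: "N \<subseteq> {0..}"
    and "a +o N = b +o N"
  shows "a = b"
proof -
  obtain s t where "s \<in> N" "a = b + s" "t \<in> N" "b = a + t"
    using assms(3) principal_ideal_subset_iff[OF assms(1)] by (metis order_refl)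
  then have "b \<le> a" "a \<le> b"
    using nonneg add_left_mono[of 0 s b] add_left_mono[of 0 t a] by auto
  then show ?thesis
    by simp
qed

lemma Min_set_plus:
  fixes S T :: "'a::{linorder, ordered_comm_monoid_add} set"
  assumes "finite S" "S \<noteq> {}" "finite T" "T \<noteq> {}"
  shows "Min (S + T) = Min S + Min T"
proof (rule Min_eqI)
  show "finite (S + T)"
    using assms by (simp add: finite_set_plus)
  show "Min S + Min T \<in> S + T"
    using assms by (intro set_plus_intro Min_in)
  show "Min S + Min T \<le> x" if "x \<in> S + T" for x
    using that assms by (auto elim!: set_plus_elim intro!: add_mono)
qed

text \<open>
  The index at which the cardinality is least is one from which no further element can be lost.
\<close>

lemma descending_finite_sets_stabilize:
  fixes S :: "nat \<Rightarrow> 'a set"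
  assumes fin: "\<And>n. n \<ge> m \<Longrightarrow> finite (S n)"
    and desc: "\<And>n. n \<ge> m \<Longrightarrow> S (Suc n) \<subseteq> S n"
  shows "\<exists>n0\<ge>m. \<forall>n\<ge>n0. S n = S (Suc n)"
proof -
  obtain n0 where n0: "n0 \<ge> m" and least: "\<And>n. n \<ge> m \<Longrightarrow> card (S n0) \<le> card (S n)"
    using ex_has_least_nat[of "\<lambda>n. n \<ge> m" m "\<lambda>n. card (S n)"] by blast
  have const: "S n = S n0" if "n \<ge> n0" for n
    using that
  proof (induction n rule: dec_induct)
    case (step n)
    then have "S (Suc n) \<subseteq> S n0"
      using desc[of n] n0 by auto
    moreover have "card (S n0) \<le> card (S (Suc n))"
      using least step n0 by simp
    ultimately show ?case
      using fin[OF n0] by (rule card_seteq[rotated])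
  qed simp
  show ?thesis
    using n0 const by (metis le_SucI)
qed

theorem accp_power_monoid_fin_if_nonneg:
  fixes M :: "'a::{linorder, ordered_cancel_comm_monoid_add} set"
  assumes sub: "add_submonoid M" and nonneg: "M \<subseteq> {0..}" and accp: "satisfies_accp M"
  shows "satisfies_accp (power_monoid_fin M)"
  unfolding satisfies_accp_def
proof (intro allI impI, elim conjE)
  let ?P = "power_monoid_fin M"
  fix S :: "nat \<Rightarrow> 'a set"
  assume mem: "\<forall>n. S n \<in> ?P" and chain: "\<forall>n. S n +o ?P \<subseteq> S (Suc n) +o ?P"
  have S: "finite (S n)" "S n \<noteq> {}" "S n \<subseteq> M" for n
    using mem by (auto simp: power_monoid_fin_def)
  have "\<forall>n. \<exists>T. T \<in> ?P \<and> S n = S (Suc n) + T"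
    using chain unfolding principal_ideal_subset_iff[OF add_submonoid_power_monoid_fin[OF sub]]
    by blast
  then obtain T where "\<forall>n. T n \<in> ?P \<and> S n = S (Suc n) + T n"
    by (rule choice[THEN exE])
  then have TP: "T n \<in> ?P" and ST: "S n = S (Suc n) + T n" for n
    by blast+
  have T: "finite (T n)" "T n \<noteq> {}" "T n \<subseteq> M" for n
    using TP[of n] by (auto simp: power_monoid_fin_def)
  have Min_S: "Min (S n) = Min (S (Suc n)) + Min (T n)" for n
    using Min_set_plus[OF S(1,2)[of "Suc n"] T(1,2)[of n]] ST[of n] by simp
  have Min_T: "Min (T n) \<in> M" for n
    using Min_in[OF T(1,2)[of n]] T(3)[of n] by auto
  have "\<forall>n. Min (S n) \<in> M"
    using Min_in[OF S(1,2)] S(3) by auto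
  moreover have "\<forall>n. Min (S n) +o M \<subseteq> Min (S (Suc n)) +o M"
    unfolding principal_ideal_subset_iff[OF sub] using Min_S Min_T by blast
  ultimately obtain m where m: "\<And>n. n \<ge> m \<Longrightarrow> Min (S n) +o M = Min (S (Suc n)) +o M"
    using accp[unfolded satisfies_accp_def, rule_format, of "\<lambda>n. Min (S n)"] by blast
  have "S (Suc n) \<subseteq> S n" if "n \<ge> m" for n
  proof -
    have "Min (S n) = Min (S (Suc n))"
      using generator_unique_if_nonneg[OF sub nonneg m[OF that]] .
    then have "Min (S (Suc n)) + Min (T n) = Min (S (Suc n)) + 0"
      using Min_S[of n] by simp
    then have "Min (T n) = 0"
      by (rule add_left_imp_eq)
    then have "0 \<in> T n"
      using Min_in[OF T(1,2)[of n]] by simp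
    then show ?thesis
      using set_zero_plus2[of "T n" "S (Suc n)"] ST[of n] by (simp add: add.commute)
  qed
  then obtain n0 where "\<forall>n\<ge>n0. S n = S (Suc n)"
    using descending_finite_sets_stabilize[of m S] S by blast
  then show "\<exists>n0. \<forall>n\<ge>n0. S n +o ?P = S (Suc n) +o ?P"
    by metis
qed

theorem proposition3p5:
  fixes M :: "rat set"
  assumes "puiseux_monoid M"
    and "satisfies_accp M"
  shows "satisfies_accp (power_monoid_fin M)"
  using assms by (simp add: puiseux_monoid_def accp_power_monoid_fin_if_nonneg)

end
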